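(* On the $U_{q^{1/2}}(\mathfrak{sl}_2)$-module $V$ on which the Chevalley generators act as \[ K\mapsto q^{N/2}A^*,\quad K^{-1}\mapsto q^{-N/2}(A^* )^{-1},\quad E\mapsto L,\quad F\mapsto q^{\frac{1-N}{2}}R, \] the equitable generators $\mathcal X,\mathcal Y,\mathcal Y^{-1},\mathcal Z$ of $U_{q^{1/2}}(\mathfrak{sl}_2)$ act as follows: \[ \mathcal X\mapsto (q-1)q^{-N/2}A^-,\quad \mathcal Y\mapsto q^{N/2}A^*,\quad \mathcal Y^{-1}\mapsto q^{-N/2}(A^* )^{-1},\quad \mathcal Z\mapsto (q-1)q^{-N/2}A^+ . \]
   Context: Let $q$ be a prime power, $GF(q)$ the field with $q$ elements, $N\ge 1$ an integer, and $\mathbf V$ an $N$-dimensional vector space over $GF(q)$. Let $X$ be the set of all subspaces of $\mathbf V$, ordered by inclusion (the projective geometry $L_N(q)$). For $y,z\in X$, $y$ covers $z$ means $z\subseteq y$ and $\dim y-\dim z=1$. ${\rm Mat}_X(\mathbb C)$ is the algebra of complex matrices with rows and columns indexed by $X$; it acts on the standard module $V=\mathbb C^X$ by left multiplication. $A^*\in{\rm Mat}_X(\mathbb C)$ is the diagonal matrix with $(y,y)$-entry $q^{-\dim y}$. $R,L\in{\rm Mat}_X(\mathbb C)$: $R_{y,z}=1$ if $y$ covers $z$ and $0$ otherwise; $L_{y,z}=1$ if $z$ covers $y$ and $0$ otherwise. Define \[ A^+=\frac{(A^* )^{-1}}{q-1}-R,\qquad A^-=\frac{(A^* )^{-1}}{q-1}+(A^*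 )^{-1}L . \] All square roots are positive. $U_{q^{1/2}}(\mathfrak{sl}_2)$ is the associative unital $\mathbb C$-algebra with (Chevalley) generators $K,K^{-1},E,F$ and relations $KK^{-1}=K^{-1}K=1$, $KE=qEK$, $KF=q^{-1}FK$, $EF-FE=\frac{K-K^{-1}}{q^{1/2}-q^{-1/2}}$. It is known that the displayed assignment of $K^{\pm1},E,F$ makes $V$ a $U_{q^{1/2}}(\mathfrak{sl}_2)$-module. The equitable presentation of $U_{q^{1/2}}(\mathfrak{sl}_2)$ has generators $\mathcal X,\mathcal Y,\mathcal Y^{-1},\mathcal Z$ and relations $\mathcal Y\mathcal Y^{-1}=\mathcal Y^{-1}\mathcal Y=1$, $\frac{q\mathcal X\mathcal Y-\mathcal Y\mathcal X}{q-1}=1$, $\frac{q\mathcal Y\mathcal Z-\mathcal Z\mathcal Y}{q-1}=1$, $\frac{q\mathcal Z\mathcal X-\mathcal X\mathcal Z}{q-1}=1$. It is identified with the Chevalley presentation via the (known) isomorphism $\mathcal X\mapsto K^{-1}+K^{-1}E(q-1)$, $\mathcal Y^{\pm1}\mapsto K^{\pm1}$, $\mathcal Z\mapsto K^{-1}-Fq^{-1/2}(q-1)$. *)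

theory Defs
  imports Complex_Main "HOL-Library.Poly_Mapping" "HOL-Algebra.QuotRing"
begin

text \<open>Words form the free monoid, written additively because the convolution product of
  \<^theory>\<open>HOL-Library.Poly_Mapping\<close> is indexed by additive monoids. Consequently the ring
  \<open>'g word \<Rightarrow>\<^sub>0 complex\<close> is the free associative unital complex algebra on \<open>'g\<close>.\<close>

datatype 'g word = Word "'g list"

instantiation word :: (type) monoid_add
begin

definition zero_word :: "'g word" where "zero_word = Word []"

fun plus_word :: "'g word \<Rightarrow> 'g word \<Rightarrow> 'g word" where
  "plus_word (Word u) (Word v) = Word (u @ v)"

instance
proof
  fix a b c :: "'g word"
  show "a + b + c = a + (b + c)" by (cases a; cases b; cases c) simp
  show "0 + a = a" by (cases a) (simp add: zero_word_def)
  show "a + 0 = a" by (cases a) (simp add: zero_word_def)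
qed

end

type_synonym 'g free_alg = "'g word \<Rightarrow>\<^sub>0 complex"

definition gen :: "'g \<Rightarrow> 'g free_alg" where
  "gen g = Poly_Mapping.single (Word [g]) 1"

definition const :: "complex \<Rightarrow> 'g free_alg" where
  "const c = Poly_Mapping.single 0 c"

definition free_ring :: "'g free_alg ring" where
  "free_ring = \<lparr>carrier = UNIV, mult = (*), one = 1, zero = 0, add = (+)\<rparr>"

text \<open>A relation \<open>a = b\<close> is encoded by the element \<open>a - b\<close>; \<open>genideal\<close> is the generated
  two-sided ideal.\<close>

definition presented_alg :: "'g free_alg set \<Rightarrow> 'g free_alg set ring" where
  "presented_alg rels = free_ring Quot (genideal free_ring rels)"

definition cls :: "'g free_alg set \<Rightarrow> 'g free_alg \<Rightarrow> 'g free_alg set" where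
  "cls rels a = a_r_coset free_ring (genideal free_ring rels) a"

definition alg_iso ::
    "'g free_alg set \<Rightarrow> 'h free_alg set \<Rightarrow> ('g free_alg set \<Rightarrow> 'h free_alg set) set" where
  "alg_iso rels rels' =
     {\<phi> \<in> ring_iso (presented_alg rels) (presented_alg rels').
        \<forall>c. \<phi> (cls rels (const c)) = cls rels' (const c)}"

definition qpow :: "nat \<Rightarrow> real \<Rightarrow> complex" where
  "qpow q a = complex_of_real (real q powr a)"

datatype chev_gen = K | Kinv | E | F

definition chev_rels :: "nat \<Rightarrow> chev_gen free_alg set" where
  "chev_rels q =
     {gen K * gen Kinv - 1,
      gen Kinv * gen K - 1,
      gen K * gen E - const (of_nat q) * (gen E * gen K),
      gen K * gen F - const (1 / of_nat q) * (gen F * gen K),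
      gen E * gen F - gen F * gen E
        - const (1 / (qpow q (1/2) - qpow q (- 1/2))) * (gen K - gen Kinv)}"

datatype equit_gen = X | Y | Yinv | Z

definition equit_rels :: "nat \<Rightarrow> equit_gen free_alg set" where
  "equit_rels q =
     {gen Y * gen Yinv - 1,
      gen Yinv * gen Y - 1,
      const (1 / (of_nat q - 1)) * (const (of_nat q) * (gen X * gen Y) - gen Y * gen X) - 1,
      const (1 / (of_nat q - 1)) * (const (of_nat q) * (gen Y * gen Z) - gen Z * gen Y) - 1,
      const (1 / (of_nat q - 1)) * (const (of_nat q) * (gen Z * gen X) - gen X * gen Z) - 1}"

abbreviation chev :: "nat \<Rightarrow> chev_gen free_alg \<Rightarrow> chev_gen free_alg set" where
  "chev q \<equiv> cls (chev_rels q)"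

abbreviation equit :: "nat \<Rightarrow> equit_gen free_alg \<Rightarrow> equit_gen free_alg set" where
  "equit q \<equiv> cls (equit_rels q)"

text \<open>The isomorphism identifying the presentations; it is determined by its values on the
  generators.\<close>

definition is_equit_identification ::
    "nat \<Rightarrow> (equit_gen free_alg set \<Rightarrow> chev_gen free_alg set) \<Rightarrow> bool" where
  "is_equit_identification q \<phi> \<longleftrightarrow>
     \<phi> \<in> alg_iso (equit_rels q) (chev_rels q) \<and>
     \<phi> (equit q (gen X)) = chev q (gen Kinv + const (of_nat q - 1) * (gen Kinv * gen E)) \<and>
     \<phi> (equit q (gen Y)) = chev q (gen K) \<and>
     \<phi> (equit q (gen Yinv)) = chev q (gen Kinv) \<and>
     \<phi> (equit q (gen Z)) = chev q (gen Kinv - const (qpow q (- 1/2) * (of_nat q - 1)) * gen F)"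

text \<open>Vectors and matrices indexed by \<open>S\<close> are represented by functions vanishing off \<open>S\<close>.\<close>

definition vecs :: "'x set \<Rightarrow> ('x \<Rightarrow> complex) set" where
  "vecs S = {v. \<forall>y. y \<notin> S \<longrightarrow> v y = 0}"

definition Mat :: "'x set \<Rightarrow> ('x \<Rightarrow> 'x \<Rightarrow> complex) ring" where
  "Mat S =
     \<lparr>carrier = {M. \<forall>y z. \<not> (y \<in> S \<and> z \<in> S) \<longrightarrow> M y z = 0},
      mult = (\<lambda>M M' y z. \<Sum>w\<in>S. M y w * M' w z),
      one = (\<lambda>y z. if y \<in> S \<and> y = z then 1 else 0),
      zero = (\<lambda>y z. 0),
      add = (\<lambda>M M' y z. M y z + M' y z)\<rparr>"

definition mat_scale :: "complex \<Rightarrow> ('x \<Rightarrow> 'x \<Rightarrow> complex) \<Rightarrow> 'x \<Rightarrow> 'x \<Rightarrow> complex" where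
  "mat_scale c M = (\<lambda>y z. c * M y z)"

definition mat_vec :: "'x set \<Rightarrow> ('x \<Rightarrow> 'x \<Rightarrow> complex) \<Rightarrow> ('x \<Rightarrow> complex) \<Rightarrow> 'x \<Rightarrow> complex" where
  "mat_vec S M v = (\<lambda>y. \<Sum>z\<in>S. M y z * v z)"

text \<open>Left module structures on \<open>vecs S\<close> that are compatible with its complex vector space
  structure.\<close>

definition is_module_on ::
    "'g free_alg set \<Rightarrow> 'x set \<Rightarrow> ('g free_alg set \<Rightarrow> ('x \<Rightarrow> complex) \<Rightarrow> 'x \<Rightarrow> complex) \<Rightarrow> bool" where
  "is_module_on rels S act \<longleftrightarrow>
     (let U = presented_alg rels in
       (\<forall>a \<in> carrier U. \<forall>v \<in> vecs S. act a v \<in> vecs S) \<and>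
       (\<forall>a \<in> carrier U. \<forall>v \<in> vecs S. \<forall>w \<in> vecs S.
          act a (\<lambda>y. v y + w y) = (\<lambda>y. act a v y + act a w y)) \<and>
       (\<forall>a \<in> carrier U. \<forall>b \<in> carrier U. \<forall>v \<in> vecs S.
          act (a \<oplus>\<^bsub>U\<^esub> b) v = (\<lambda>y. act a v y + act b v y)) \<and>
       (\<forall>a \<in> carrier U. \<forall>b \<in> carrier U. \<forall>v \<in> vecs S.
          act (a \<otimes>\<^bsub>U\<^esub> b) v = act a (act b v)) \<and>
       (\<forall>c. \<forall>v \<in> vecs S. act (cls rels (const c)) v = (\<lambda>y. c * v y)))"

definition acts_as ::
    "'x set \<Rightarrow> ('a \<Rightarrow> ('x \<Rightarrow> complex) \<Rightarrow> 'x \<Rightarrow> complex) \<Rightarrow> 'a \<Rightarrow> ('x \<Rightarrow> 'x \<Rightarrow> complex) \<Rightarrow> bool" where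
  "acts_as S act a M \<longleftrightarrow> (\<forall>v \<in> vecs S. act a v = mat_vec S M v)"

text \<open>The vector space is given by its scalar multiplication \<open>s\<close> on a whole type.\<close>

definition subspaces :: "('k::field \<Rightarrow> 'v::ab_group_add \<Rightarrow> 'v) \<Rightarrow> 'v set set" where
  "subspaces s = {W. module.subspace s W}"

definition covers :: "('k::field \<Rightarrow> 'v::ab_group_add \<Rightarrow> 'v) \<Rightarrow> 'v set \<Rightarrow> 'v set \<Rightarrow> bool" where
  "covers s y z \<longleftrightarrow> y \<in> subspaces s \<and> z \<in> subspaces s \<and> z \<subseteq> y
     \<and> int (vector_space.dim s y) - int (vector_space.dim s z) = 1"

definition field_order :: "('k::{field,finite} \<Rightarrow> 'v::ab_group_add \<Rightarrow> 'v) \<Rightarrow> nat" where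
  "field_order s = card (UNIV :: 'k set)"

definition Astar ::
    "('k::{field,finite} \<Rightarrow> 'v::ab_group_add \<Rightarrow> 'v) \<Rightarrow> 'v set \<Rightarrow> 'v set \<Rightarrow> complex" where
  "Astar s = (\<lambda>y z. if y \<in> subspaces s \<and> y = z
                     then qpow (field_order s) (- real (vector_space.dim s y)) else 0)"

definition Astar_inv ::
    "('k::{field,finite} \<Rightarrow> 'v::ab_group_add \<Rightarrow> 'v) \<Rightarrow> 'v set \<Rightarrow> 'v set \<Rightarrow> complex" where
  "Astar_inv s = inv\<^bsub>Mat (subspaces s)\<^esub> (Astar s)"

definition raising ::
    "('k::field \<Rightarrow> 'v::ab_group_add \<Rightarrow> 'v) \<Rightarrow> 'v set \<Rightarrow> 'v set \<Rightarrow> complex" where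
  "raising s = (\<lambda>y z. if covers s y z then 1 else 0)"

definition lowering ::
    "('k::field \<Rightarrow> 'v::ab_group_add \<Rightarrow> 'v) \<Rightarrow> 'v set \<Rightarrow> 'v set \<Rightarrow> complex" where
  "lowering s = (\<lambda>y z. if covers s z y then 1 else 0)"

definition Aplus ::
    "('k::{field,finite} \<Rightarrow> 'v::ab_group_add \<Rightarrow> 'v) \<Rightarrow> 'v set \<Rightarrow> 'v set \<Rightarrow> complex" where
  "Aplus s = (\<lambda>y z. Astar_inv s y z / (of_nat (field_order s) - 1) - raising s y z)"

definition Aminus ::
    "('k::{field,finite} \<Rightarrow> 'v::ab_group_add \<Rightarrow> 'v) \<Rightarrow> 'v set \<Rightarrow> 'v set \<Rightarrow> complex" where
  "Aminus s = (\<lambda>y z. Astar_inv s y z / (of_nat (field_order s) - 1)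
                      + (Astar_inv s \<otimes>\<^bsub>Mat (subspaces s)\<^esub> lowering s) y z)"

end

theory Submission
  imports Defs
begin

text \<open>The identification sends each equitable generator to the class of an explicit
  noncommutative polynomial in \<open>K\<close>, \<open>Kinv\<close>, \<open>E\<close>,
  \<open>F\<close>. Taking classes is a ring homomorphism and the module is linear, so such a class
  acts by the same polynomial in the given matrices; \<open>acts_as_add\<close>,
  \<open>acts_as_mult\<close>, \<open>acts_as_const_mult\<close> and \<open>acts_as_diff\<close>
  express this. For \<open>Y\<close> and \<open>Yinv\<close> nothing remains. Writing c = q^(-N/2)
  and B for the inverse of A*, the generator \<open>X\<close> acts as cB + (q-1)cBL, and
  \<open>Z\<close> as cB - q^(-1/2)(q-1)q^((1-N)/2)R = cB - (q-1)cR. Taking out (q-1)c leaves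
  B/(q-1) + BL and B/(q-1) - R, which are A^- and A^+.\<close>

lemma ring_free_ring: "ring (free_ring :: 'g free_alg ring)"
proof (rule ringI)
  show "abelian_group (free_ring :: 'g free_alg ring)"
  proof (rule abelian_groupI)
    fix x :: "'g free_alg"
    show "\<exists>y\<in>carrier free_ring. y \<oplus>\<^bsub>free_ring\<^esub> x = \<zero>\<^bsub>free_ring\<^esub>"
      by (rule bexI[of _ "- x"]) (simp_all add: free_ring_def)
  qed (simp_all add: free_ring_def algebra_simps)
  show "monoid (free_ring :: 'g free_alg ring)"
    by unfold_locales (simp_all add: free_ring_def algebra_simps)
qed (simp_all add: free_ring_def algebra_simps)

text \<open>This is the canonical projection modulo a two-sided ideal. It lets later arguments
  compute with representatives in the free algebra instead of cosets.\<close>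

lemma cls_ring_hom: "cls rels \<in> ring_hom free_ring (presented_alg rels)"
proof -
  interpret ring free_ring by (rule ring_free_ring)
  have "ideal (genideal free_ring rels) free_ring"
    by (rule genideal_ideal) (simp add: free_ring_def)
  then show ?thesis
    unfolding presented_alg_def cls_def[abs_def] by (rule ideal.rcos_ring_hom)
qed

lemma cls_carrier: "cls rels a \<in> carrier (presented_alg rels)"
  using ring_hom_closed[OF cls_ring_hom] by (simp add: free_ring_def)

lemma cls_add: "cls rels (a + b) = cls rels a \<oplus>\<^bsub>presented_alg rels\<^esub> cls rels b"
  using ring_hom_add[OF cls_ring_hom, of a b rels] by (simp add: free_ring_def)

lemma cls_mult: "cls rels (a * b) = cls rels a \<otimes>\<^bsub>presented_alg rels\<^esub> cls rels b"
  using ring_hom_mult[OF cls_ring_hom, of a b rels] by (simp add: free_ring_def)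

lemma const_minus_one_mult: "const (- 1) * a = - a" for a :: "'g free_alg"
proof -
  have "const (- 1) = - (1 :: 'g free_alg)"
    by (simp add: const_def single_uminus)
  then show ?thesis by simp
qed

lemma mat_vec_add: "mat_vec S (\<lambda>y z. M y z + M' y z) v = (\<lambda>y. mat_vec S M v y + mat_vec S M' v y)"
  by (simp add: mat_vec_def sum.distrib distrib_right)

lemma mat_vec_scale: "mat_vec S (mat_scale c M) v = (\<lambda>y. c * mat_vec S M v y)"
  by (simp add: mat_vec_def mat_scale_def sum_distrib_left mult.assoc)

text \<open>Exchanging the two sums suffices. For infinite \<open>S\<close> every sum over it is 0
  by convention, so the identity holds there as well.\<close>

lemma mat_vec_mult: "mat_vec S (M \<otimes>\<^bsub>Mat S\<^esub> M') v = mat_vec S M (mat_vec S M' v)"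
proof
  fix y
  have "mat_vec S (M \<otimes>\<^bsub>Mat S\<^esub> M') v y = (\<Sum>z\<in>S. \<Sum>w\<in>S. M y w * (M' w z * v z))"
    by (simp add: mat_vec_def Mat_def sum_distrib_right mult.assoc)
  also have "\<dots> = (\<Sum>w\<in>S. \<Sum>z\<in>S. M y w * (M' w z * v z))"
    by (rule sum.swap)
  finally show "mat_vec S (M \<otimes>\<^bsub>Mat S\<^esub> M') v y = mat_vec S M (mat_vec S M' v) y"
    by (simp add: mat_vec_def sum_distrib_left)
qed

lemma module_act_vecs:
  assumes "is_module_on rels S act" "v \<in> vecs S"
  shows "act (cls rels a) v \<in> vecs S"
  using assms cls_carrier[of rels a] by (simp add: is_module_on_def Let_def)

lemma module_act_add:
  assumes "is_module_on rels S act" "v \<in> vecs S"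
  shows "act (cls rels (a + b)) v = (\<lambda>y. act (cls rels a) v y + act (cls rels b) v y)"
  using assms cls_carrier[of rels a] cls_carrier[of rels b]
  by (simp add: is_module_on_def Let_def cls_add)

lemma module_act_mult:
  assumes "is_module_on rels S act" "v \<in> vecs S"
  shows "act (cls rels (a * b)) v = act (cls rels a) (act (cls rels b) v)"
  using assms cls_carrier[of rels a] cls_carrier[of rels b]
  by (simp add: is_module_on_def Let_def cls_mult)

lemma module_act_const:
  assumes "is_module_on rels S act" "v \<in> vecs S"
  shows "act (cls rels (const c)) v = (\<lambda>y. c * v y)"
  using assms by (simp add: is_module_on_def Let_def)

lemma acts_as_add:
  assumes "is_module_on rels S act"
    and "acts_as S act (cls rels a) M" "acts_as S act (cls rels b) M'"
  shows "acts_as S act (cls rels (a + b)) (\<lambda>y z. M y z + M' y z)"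
  using assms by (simp add: acts_as_def module_act_add mat_vec_add)

lemma acts_as_mult:
  assumes "is_module_on rels S act"
    and "acts_as S act (cls rels a) M" "acts_as S act (cls rels b) M'"
  shows "acts_as S act (cls rels (a * b)) (M \<otimes>\<^bsub>Mat S\<^esub> M')"
  unfolding acts_as_def
proof
  fix v :: "'b \<Rightarrow> complex" assume v: "v \<in> vecs S"
  \<comment> \<open>\<open>acts_as\<close> only constrains vectors supported on \<open>S\<close>, so
    the intermediate vector must lie in \<open>vecs S\<close> before the hypothesis on
    \<open>a\<close> applies to it.\<close>
  have "act (cls rels b) v \<in> vecs S"
    using assms(1) v by (rule module_act_vecs)
  then show "act (cls rels (a * b)) v = mat_vec S (M \<otimes>\<^bsub>Mat S\<^esub> M') v"
    using assms(2,3) v by (simp add: acts_as_def module_act_mult[OF assms(1) v] mat_vec_mult)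
qed

lemma acts_as_const_mult:
  assumes "is_module_on rels S act" and "acts_as S act (cls rels a) M"
  shows "acts_as S act (cls rels (const c * a)) (mat_scale c M)"
  unfolding acts_as_def
proof
  fix v :: "'b \<Rightarrow> complex" assume v: "v \<in> vecs S"
  have "act (cls rels a) v \<in> vecs S"
    using assms(1) v by (rule module_act_vecs)
  then show "act (cls rels (const c * a)) v = mat_vec S (mat_scale c M) v"
    using assms v
    by (simp add: acts_as_def module_act_mult[OF assms(1) v] module_act_const[OF assms(1)]
        mat_vec_scale)
qed

text \<open>The module axioms mention sums, products and scalars only, so a - b is handled as a +
  (-1)b.\<close>

lemma acts_as_diff:
  assumes "is_module_on rels S act"
    and "acts_as S act (cls rels a) M" "acts_as S act (cls rels b) M'"
  shows "acts_as S act (cls rels (a - b)) (\<lambda>y z. M y z - M' y z)"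
  using acts_as_add[OF assms(1,2) acts_as_const_mult[OF assms(1,3), of "- 1"]]
  by (simp add: const_minus_one_mult mat_scale_def)

lemma qpow_mult: "qpow q a * qpow q b = qpow q (a + b)"
  by (simp add: qpow_def powr_add)

theorem theorem13p5:
  fixes s :: "'k::{field,finite} \<Rightarrow> 'v::ab_group_add \<Rightarrow> 'v"
    and q N :: nat
    and act :: "chev_gen free_alg set \<Rightarrow> ('v set \<Rightarrow> complex) \<Rightarrow> 'v set \<Rightarrow> complex"
    and \<phi> :: "equit_gen free_alg set \<Rightarrow> chev_gen free_alg set"
  assumes "vector_space s"
    and "q = card (UNIV :: 'k set)"
    and "N \<ge> 1"
    and "vector_space.dim s (UNIV :: 'v set) = N"
    and "is_module_on (chev_rels q) (subspaces s) act"
    and "acts_as (subspaces s) act (chev q (gen K))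
           (mat_scale (qpow q (real N / 2)) (Astar s))"
    and "acts_as (subspaces s) act (chev q (gen Kinv))
           (mat_scale (qpow q (- real N / 2)) (Astar_inv s))"
    and "acts_as (subspaces s) act (chev q (gen E)) (lowering s)"
    and "acts_as (subspaces s) act (chev q (gen F))
           (mat_scale (qpow q ((1 - real N) / 2)) (raising s))"
    and "is_equit_identification q \<phi>"
  shows "acts_as (subspaces s) act (\<phi> (equit q (gen X)))
           (mat_scale ((of_nat q - 1) * qpow q (- real N / 2)) (Aminus s))
       \<and> acts_as (subspaces s) act (\<phi> (equit q (gen Y)))
           (mat_scale (qpow q (real N / 2)) (Astar s))
       \<and> acts_as (subspaces s) act (\<phi> (equit q (gen Yinv)))
           (mat_scale (qpow q (- real N / 2)) (Astar_inv s))
       \<and> acts_as (subspaces s) act (\<phi> (equit q (gen Z)))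
           (mat_scale ((of_nat q - 1) * qpow q (- real N / 2)) (Aplus s))"
proof -
  let ?S = "subspaces s" and ?c = "qpow q (- real N / 2)"
  note module = assms(5)
  \<comment> \<open>A field has 0 and 1 distinct, so q is at least 2 and the denominators q - 1 in
    \<open>Aplus\<close> and \<open>Aminus\<close> can be cleared.\<close>
  have "card {0, 1 :: 'k} \<le> q"
    unfolding assms(2) by (rule card_mono) simp_all
  then have q: "of_nat q - 1 \<noteq> (0 :: complex)"
    using of_nat_eq_iff[of q 1, where 'a = complex] by auto
  have fo: "field_order s = q"
    by (simp add: field_order_def assms(2))
  have \<phi>:
    "\<phi> (equit q (gen X)) = chev q (gen Kinv + const (of_nat q - 1) * (gen Kinv * gen E))"
    "\<phi> (equit q (gen Y)) = chev q (gen K)"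
    "\<phi> (equit q (gen Yinv)) = chev q (gen Kinv)"
    "\<phi> (equit q (gen Z)) = chev q (gen Kinv - const (qpow q (- 1/2) * (of_nat q - 1)) * gen F)"
    using assms(10) unfolding is_equit_identification_def by auto
  \<comment> \<open>Compared entry by entry: the scalar \<open>?c\<close> is pulled out of the sum
    defining the matrix product, while \<open>Astar_inv s\<close> stays an opaque symbol.\<close>
  have "(\<lambda>y z. mat_scale ?c (Astar_inv s) y z
          + mat_scale (of_nat q - 1) (mat_scale ?c (Astar_inv s) \<otimes>\<^bsub>Mat ?S\<^esub> lowering s) y z)
        = mat_scale ((of_nat q - 1) * ?c) (Aminus s)"
    using q by (simp add: fun_eq_iff mat_scale_def Aminus_def Mat_def fo distrib_left
        mult.assoc flip: sum_distrib_left)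
  then have X: "acts_as ?S act (\<phi> (equit q (gen X)))
      (mat_scale ((of_nat q - 1) * ?c) (Aminus s))"
    using acts_as_add[OF module assms(7) acts_as_const_mult[OF module
        acts_as_mult[OF module assms(7,8)], of "of_nat q - 1"]]
    by (simp add: \<phi>)
  \<comment> \<open>The q^(-1/2) in the image of \<open>Z\<close> is what turns the normalization
    (1-N)/2 of \<open>F\<close> into the exponent -N/2.\<close>
  have "qpow q (- 1/2) * qpow q ((1 - real N) / 2) = ?c"
    by (simp add: qpow_mult diff_divide_distrib)
  \<comment> \<open>Bracketed as it arises when both uses of \<open>mat_scale\<close> are unfolded,
    with \<open>r\<close> standing for an entry of \<open>raising s\<close>.\<close>
  then have "qpow q (- 1/2) * (of_nat q - 1) * (qpow q ((1 - real N) / 2) * r)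
      = (of_nat q - 1) * ?c * r" for r
    by (simp add: mult_ac)
  then have "(\<lambda>y z. mat_scale ?c (Astar_inv s) y z
          - mat_scale (qpow q (- 1/2) * (of_nat q - 1))
              (mat_scale (qpow q ((1 - real N) / 2)) (raising s)) y z)
        = mat_scale ((of_nat q - 1) * ?c) (Aplus s)"
    using q by (simp add: fun_eq_iff mat_scale_def Aplus_def fo right_diff_distrib)
  then have Z: "acts_as ?S act (\<phi> (equit q (gen Z)))
      (mat_scale ((of_nat q - 1) * ?c) (Aplus s))"
    using acts_as_diff[OF module assms(7) acts_as_const_mult[OF module assms(9),
        of "qpow q (- 1/2) * (of_nat q - 1)"]]
    by (simp add: \<phi>)
  show ?thesis
    using X Z assms(6,7) by (simp add: \<phi>)
qed

end
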